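(* Let $K$ be a locally compact field with a nontrivial non-Archimedean absolute value, with ring of integers $\mathcal{O}$ and normalized Haar measure $\mu$. If $f:\mathcal{O}\to\mathbb{R}$ is Haar-integrable and $V_{\mathrm{Berk}}(f)<+\infty$, then there exists a unique continuous function $g:\mathcal{O}\to\mathbb{R}$ such that $f(x)=g(x)$ for $\mu$-almost all $x\in\mathcal{O}$.
   Context: $\mathcal{O}=\{x\in K:|x|\le1\}$, $\pi$ a uniformizer, $q$ the order of $\mathcal{O}/\pi\mathcal{O}$, $|\pi|=1/q$; $\mu$ is Haar measure on $\mathcal{O}$ with $\mu(\mathcal{O})=1$. A disc is $D_r(a)=\{x\in K:|x-a|\le r\}$, $r\in q^{\mathbb{Z}}$, $r>0$. Let $\mathcal{D}_{\mathcal{O}}$ be the set of all discs contained in $\mathcal{O}$; write $D'\prec D$ if $D'\subseteq D$ and $\mu(D')=\mu(D)/q$. For a Haar-integrable $f$ and $D\in\mathcal{D}_{\mathcal{O}}$, set $f(D)=\frac{1}{\mu(D)}\int_D f\,d\mu$. The Berkovich-analytic variation is $V_{\mathrm{Berk}}(f)=\sum_{D\in\mathcal{D}_{\mathcal{O}}}\sum_{D'\prec D}|f(D')-f(D)|$. *)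

theory Defs
  imports "HOL-Analysis.Analysis" "HOL-Library.FuncSet"
begin

text \<open>
  A field with a nontrivial non-Archimedean absolute value. The metric of the ambient type class
  is required to be the one induced by the absolute value, so that all topological notions of the
  library (compactness, Borel sets, continuity) refer to the valuation topology.
\<close>

locale nonarchimedean_field =
  fixes av :: "'a :: {field, metric_space} \<Rightarrow> real"
  assumes av_nonneg: "0 \<le> av x"
    and av_eq_0_iff: "av x = 0 \<longleftrightarrow> x = 0"
    and av_mult: "av (x * y) = av x * av y"
    and av_add_le: "av (x + y) \<le> max (av x) (av y)"
    and av_nontrivial: "\<exists>x. x \<noteq> 0 \<and> av x \<noteq> 1"
    and dist_eq_av: "dist x y = av (x - y)"

definition ring_of_integers :: "('a :: field \<Rightarrow> real) \<Rightarrow> 'a set" where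
  "ring_of_integers av = {x. av x \<le> 1}"

text \<open>A uniformizer is a generator of the maximal ideal of the ring of integers.\<close>

definition uniformizer :: "('a :: field \<Rightarrow> real) \<Rightarrow> 'a \<Rightarrow> bool" where
  "uniformizer av \<pi> \<longleftrightarrow> {x. av x < 1} = (\<lambda>z. \<pi> * z) ` ring_of_integers av"

text \<open>The order of the quotient of the ring of integers by the ideal generated by \<open>\<pi>\<close>.\<close>

definition residue_order :: "('a :: field \<Rightarrow> real) \<Rightarrow> 'a \<Rightarrow> nat" where
  "residue_order av \<pi> =
     card (ring_of_integers av //
       {(x, y) \<in> ring_of_integers av \<times> ring_of_integers av.
          x - y \<in> (\<lambda>z. \<pi> * z) ` ring_of_integers av})"

text \<open>
  A translation-invariant Borel probability measure on the ring of integers. As the ring of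
  integers of a locally compact field is a compact metric space, regularity is automatic.
\<close>

definition normalized_haar_measure ::
    "('a :: {field, metric_space} \<Rightarrow> real) \<Rightarrow> 'a measure \<Rightarrow> bool" where
  "normalized_haar_measure av \<mu> \<longleftrightarrow>
     sets \<mu> = sets (restrict_space borel (ring_of_integers av)) \<and>
     emeasure \<mu> (ring_of_integers av) = 1 \<and>
     (\<forall>a \<in> ring_of_integers av. \<forall>A \<in> sets \<mu>. emeasure \<mu> ((\<lambda>x. a + x) ` A) = emeasure \<mu> A)"

definition disc :: "('a :: field \<Rightarrow> real) \<Rightarrow> 'a \<Rightarrow> real \<Rightarrow> 'a set" where
  "disc av a r = {x. av (x - a) \<le> r}"

text \<open>Discs are sets: one disc has many centres, but is counted once.\<close>

definition discs :: "('a :: field \<Rightarrow> real) \<Rightarrow> nat \<Rightarrow> 'a set set" where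
  "discs av q =
     {D. (\<exists>a (k :: int). D = disc av a (real q powi k)) \<and> D \<subseteq> ring_of_integers av}"

definition disc_children ::
    "('a :: field \<Rightarrow> real) \<Rightarrow> nat \<Rightarrow> 'a measure \<Rightarrow> 'a set \<Rightarrow> 'a set set" where
  "disc_children av q \<mu> D =
     {D' \<in> discs av q. D' \<subseteq> D \<and> measure \<mu> D' = measure \<mu> D / real q}"

definition disc_mean :: "'a measure \<Rightarrow> ('a \<Rightarrow> real) \<Rightarrow> 'a set \<Rightarrow> real" where
  "disc_mean \<mu> f D = 1 / measure \<mu> D * (LINT x:D|\<mu>. f x)"

text \<open>
  The variation takes values in \<^typ>\<open>ennreal\<close>, where every family is summable, so that
  finiteness is a genuine condition.
\<close>

definition berkovich_variation ::
    "('a :: field \<Rightarrow> real) \<Rightarrow> nat \<Rightarrow> 'a measure \<Rightarrow> ('a \<Rightarrow> real) \<Rightarrow> ennreal" where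
  "berkovich_variation av q \<mu> f =
     (\<Sum>\<^sub>\<infinity>D \<in> discs av q. \<Sum>\<^sub>\<infinity>D' \<in> disc_children av q \<mu> D.
        ennreal \<bar>disc_mean \<mu> f D' - disc_mean \<mu> f D\<bar>)"

end

theory Submission
  imports Defs "HOL-Probability.Probability_Measure"
begin

text \<open>
  Let \<open>f\<^sub>n(x)\<close> be the mean of \<open>f\<close> over the disc of radius \<open>q\<^sup>-\<^sup>n\<close> about \<open>x\<close>. Each \<open>f\<^sub>n\<close> is locally
  constant, and \<open>\<Sum>\<^sub>n sup \<bar>f\<^sub>n\<^sub>+\<^sub>1 - f\<^sub>n\<bar>\<close> is at most the variation of \<open>f\<close>, so \<open>f\<^sub>n\<close> converges uniformly to
  a continuous \<open>g\<close>. On a disc of radius \<open>q\<^sup>-\<^sup>m\<close> the integrals of \<open>f\<close> and of \<open>f\<^sub>n\<close>, \<open>n \<ge> m\<close>, agree, hence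
  so do those of \<open>f\<close> and \<open>g\<close>; the discs form an intersection-stable generator of the Borel sets,
  therefore \<open>f = g\<close> almost everywhere. Uniqueness holds because every disc has positive measure.
\<close>

section \<open>Elementary properties of the absolute value\<close>

lemma (in nonarchimedean_field) av_zero [simp]: "av 0 = 0"
  by (simp add: av_eq_0_iff)

lemma (in nonarchimedean_field) av_one [simp]: "av 1 = 1"
  using av_mult[of 1 1] av_eq_0_iff[of 1] by auto

lemma (in nonarchimedean_field) av_uminus [simp]: "av (- x) = av x"
proof -
  have "av (- 1) * av (- 1) = 1"
    using av_mult[of "- 1" "- 1"] by simp
  hence "av (- 1) = 1"
    using av_nonneg[of "- 1"] by (simp add: square_eq_1_iff)
  thus ?thesis using av_mult[of "- 1" x] by simp
qed

lemma (in nonarchimedean_field) av_minus_commute: "av (x - y) = av (y - x)"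
  using av_uminus[of "x - y"] by simp

lemma (in nonarchimedean_field) av_diff_triangle: "av (x - z) \<le> max (av (x - y)) (av (y - z))"
  using av_add_le[of "x - y" "y - z"] by simp

lemma (in nonarchimedean_field) av_power: "av (x ^ n) = av x ^ n"
  by (induction n) (auto simp: av_mult)

text \<open>Links discs to the metric topology: as closed balls they are Borel sets.\<close>

lemma (in nonarchimedean_field) disc_eq_cball: "disc av a r = cball a r"
  by (auto simp: disc_def dist_eq_av av_minus_commute)

section \<open>Discs of radius q^(-n) and the ultrametric geometry of their inclusions\<close>

locale haar_integers = nonarchimedean_field av
  for av :: "'a :: {field, metric_space} \<Rightarrow> real" +
  fixes \<pi> :: 'a and q :: nat and \<mu> :: "'a measure"
  assumes uniformizer: "uniformizer av \<pi>"
    and q_eq: "q = residue_order av \<pi>"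
    and av_uniformizer: "av \<pi> = 1 / real q"
    and haar: "normalized_haar_measure av \<mu>"
begin

abbreviation \<O> :: "'a set" where "\<O> \<equiv> ring_of_integers av"

text \<open>In algebraic terms this is the coset of the ideal generated by \<open>\<pi> ^ n\<close>
  through \<open>a\<close>. The level is a natural number, so a cell centred in \<open>\<O>\<close>
  stays in \<open>\<O>\<close>.\<close>

definition cell :: "nat \<Rightarrow> 'a \<Rightarrow> 'a set" where
  "cell n a = disc av a ((1 / real q) ^ n)"

lemma mem_integers: "x \<in> \<O> \<longleftrightarrow> av x \<le> 1"
  by (simp add: ring_of_integers_def)

lemma mem_cell: "x \<in> cell n a \<longleftrightarrow> av (x - a) \<le> (1 / real q) ^ n"
  by (simp add: cell_def disc_def)

text \<open>Nontriviality makes the maximal ideal nonzero, so its generator satisfies 0 <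
  \<open>av \<pi>\<close> < 1; the normalization \<open>av \<pi> = 1 / real q\<close> then excludes
  the two small values of \<open>q\<close>.\<close>

lemma q_ge_2: "q \<ge> 2"
proof -
  have un: "{x. av x < 1} = (\<lambda>z. \<pi> * z) ` \<O>"
    using uniformizer by (simp add: uniformizer_def)
  obtain x where x: "x \<noteq> 0" "av x \<noteq> 1" using av_nontrivial by blast
  have "av x > 0" using x av_nonneg[of x] av_eq_0_iff[of x] by linarith
  \<comment> \<open>An element of absolute value above 1 is replaced by its inverse.\<close>
  have "\<exists>y. y \<noteq> 0 \<and> av y < 1"
  proof (cases "av x < 1")
    case True
    thus ?thesis using x by blast
  next
    case False
    have "av (inverse x) * av x = 1" using av_mult[of "inverse x" x] x by simp
    hence "av (inverse x) = 1 / av x" using \<open>av x > 0\<close> by (simp add: field_simps)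
    hence "av (inverse x) < 1" using False x by simp
    thus ?thesis using x by (intro exI[of _ "inverse x"]) simp
  qed
  then obtain y where y: "y \<noteq> 0" "av y < 1" by blast
  have "y \<in> (\<lambda>z. \<pi> * z) ` \<O>" using y un by blast
  hence "\<pi> \<noteq> 0" using y by auto
  have "1 \<in> \<O>" by (simp add: mem_integers)
  hence "\<pi> \<in> (\<lambda>z. \<pi> * z) ` \<O>" by (metis imageI mult.right_neutral)
  hence "av \<pi> < 1" using un by blast
  moreover have "av \<pi> \<noteq> 0" using \<open>\<pi> \<noteq> 0\<close> av_eq_0_iff by blast
  \<comment> \<open>Since \<open>1 / 0 = 0\<close>, the case \<open>q = 0\<close> would force
    \<open>av \<pi> = 0\<close>.\<close>
  ultimately have "q \<noteq> 0" "q \<noteq> 1" using av_uniformizer by auto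
  thus ?thesis by linarith
qed

lemma radius_pos: "(1 / real q) ^ n > 0"
  using q_ge_2 by simp

lemma radius_le_1: "(1 / real q) ^ n \<le> 1"
  using q_ge_2 by (intro power_le_one) auto

lemma radius_mono: "m \<le> n \<Longrightarrow> (1 / real q) ^ n \<le> (1 / real q) ^ m"
  using q_ge_2 by (intro power_decreasing) auto

lemma uniformizer_nonzero: "\<pi> \<noteq> 0"
  using av_uniformizer q_ge_2 by auto

lemma av_uniformizer_power: "av (\<pi> ^ n) = (1 / real q) ^ n"
  by (simp add: av_power av_uniformizer)

lemma cell_self: "a \<in> cell n a"
  using radius_pos[of n] by (simp add: mem_cell)

text \<open>By the ultrametric inequality, the distance of \<open>x\<close> to one centre is at most
  the maximum of its distance to the other centre and the radius.\<close>

lemma cell_eqI: assumes "b \<in> cell n a" shows "cell n b = cell n a"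
proof -
  have "x \<in> cell n b \<longleftrightarrow> x \<in> cell n a" for x
    using assms av_diff_triangle[of x a b] av_diff_triangle[of x b a] av_minus_commute[of a b]
    by (auto simp: mem_cell)
  thus ?thesis by blast
qed

lemma cell_eq_iff: "cell n b = cell n a \<longleftrightarrow> b \<in> cell n a"
  using cell_eqI cell_self by metis

lemma cell_mono: "m \<le> n \<Longrightarrow> cell n a \<subseteq> cell m a"
  using radius_mono[of m n] by (force simp: mem_cell)

lemma cell_subset: assumes "a \<in> \<O>" shows "cell n a \<subseteq> \<O>"
proof
  fix x assume "x \<in> cell n a"
  hence "av (x - a) \<le> 1" using radius_le_1[of n] by (simp add: mem_cell)
  thus "x \<in> \<O>" using assms av_add_le[of "x - a" a] by (simp add: mem_integers)
qed

lemma cell_0: assumes "a \<in> \<O>" shows "cell 0 a = \<O>"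
proof -
  have "\<O> = cell 0 0" by (auto simp: mem_cell mem_integers)
  thus ?thesis using assms cell_eqI by blast
qed

text \<open>A common point may serve as centre of both cells, and then the radii decide the
  inclusion.\<close>

lemma cell_cases:
  assumes "m \<le> n" obtains "cell n b \<subseteq> cell m a" | "cell n b \<inter> cell m a = {}"
proof (cases "cell n b \<inter> cell m a = {}")
  case False
  then obtain x where "x \<in> cell n b" "x \<in> cell m a" by blast
  hence "cell n x = cell n b" "cell m x = cell m a" by (simp_all only: cell_eq_iff)
  thus ?thesis using cell_mono[OF assms, of x] that by auto
qed (rule that)

section \<open>Scaling by the uniformizer and counting subdiscs\<close>

text \<open>The absolute value of \<open>\<pi> ^ n\<close> is exactly the radius, so division by it
  turns the disc condition into integrality.\<close>

lemma mem_cell_conv: "x \<in> cell n a \<longleftrightarrow> (\<exists>z\<in>\<O>. x = a + \<pi> ^ n * z)"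
proof
  assume x: "x \<in> cell n a"
  define z where "z = (x - a) / \<pi> ^ n"
  have eq: "x = a + \<pi> ^ n * z" using uniformizer_nonzero by (simp add: z_def)
  hence "av (x - a) = (1 / real q) ^ n * av z"
    by (simp add: av_mult av_uniformizer_power)
  hence "(1 / real q) ^ n * av z \<le> (1 / real q) ^ n * 1" using x by (simp add: mem_cell)
  hence "z \<in> \<O>" using radius_pos[of n] mult_le_cancel_left_pos by (auto simp: mem_integers)
  thus "\<exists>z\<in>\<O>. x = a + \<pi> ^ n * z" using eq by blast
next
  assume "\<exists>z\<in>\<O>. x = a + \<pi> ^ n * z"
  then obtain z where "av z \<le> 1" "x = a + \<pi> ^ n * z" by (auto simp: mem_integers)
  thus "x \<in> cell n a"
    using radius_pos[of n] mult_left_mono[of "av z" 1 "(1 / real q) ^ n"]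
    by (simp add: mem_cell av_mult av_uniformizer_power)
qed

text \<open>Used for \<open>n = 0\<close> as translation, and for \<open>m = 1\<close> to carry
  residue classes of \<open>\<O>\<close> into a smaller disc.\<close>

lemma cell_affine: "(\<lambda>x. a + \<pi> ^ n * x) ` cell m b = cell (n + m) (a + \<pi> ^ n * b)"
proof -
  have "x \<in> (\<lambda>x. a + \<pi> ^ n * x) ` cell m b \<longleftrightarrow> x \<in> cell (n + m) (a + \<pi> ^ n * b)" for x
    by (auto simp: image_iff mem_cell_conv Bex_def power_add algebra_simps)
  thus ?thesis by blast
qed

lemma cell_conv: "cell n a = (\<lambda>z. a + \<pi> ^ n * z) ` \<O>"
  using mem_cell_conv by auto

text \<open>The congruence classes modulo \<open>\<pi>\<close> are the cells of level 1. Their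
  number is finite because \<open>card\<close> of an infinite set is 0, whereas \<open>q\<close> is
  positive.\<close>

lemma card_residue_cells: "card (cell 1 ` \<O>) = q" and finite_residue_cells: "finite (cell 1 ` \<O>)"
proof -
  let ?R = "{(x, y) \<in> \<O> \<times> \<O>. x - y \<in> (\<lambda>z. \<pi> * z) ` \<O>}"
  have "?R `` {x} = cell 1 x" if "x \<in> \<O>" for x
  proof -
    have "y \<in> ?R `` {x} \<longleftrightarrow> y \<in> cell 1 x" for y
    proof -
      have "x - y \<in> (\<lambda>z. \<pi> * z) ` \<O> \<longleftrightarrow> x \<in> cell 1 y"
        by (auto simp: mem_cell_conv image_iff algebra_simps)
      also have "\<dots> \<longleftrightarrow> y \<in> cell 1 x" by (simp add: mem_cell av_minus_commute)
      finally show ?thesis using that cell_subset[OF that, of 1] by auto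
    qed
    thus ?thesis by blast
  qed
  hence "\<O> // ?R = cell 1 ` \<O>" by (auto simp: quotient_def)
  thus card: "card (cell 1 ` \<O>) = q" by (simp add: q_eq residue_order_def)
  show "finite (cell 1 ` \<O>)" using card q_ge_2 by (intro card_ge_0_finite) simp
qed

lemma subcells_conv: "cell (Suc n) ` cell n a = (\<lambda>C. (\<lambda>x. a + \<pi> ^ n * x) ` C) ` cell 1 ` \<O>"
  by (subst cell_conv) (simp add: image_image cell_affine)

text \<open>An injective affine map transports the \<open>q\<close> residue classes of
  \<open>\<O>\<close> to the subcells.\<close>

lemma card_subcells: "card (cell (Suc n) ` cell n a) = q"
proof -
  have "inj (\<lambda>x. a + \<pi> ^ n * x)" using uniformizer_nonzero by (auto intro: injI)
  hence "inj_on (\<lambda>C. (\<lambda>x. a + \<pi> ^ n * x) ` C) (cell 1 ` \<O>)"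
    by (auto intro!: inj_onI simp: inj_image_eq_iff)
  thus ?thesis unfolding subcells_conv by (simp only: card_image card_residue_cells)
qed

lemma finite_subcells: "finite (cell (Suc n) ` cell n a)"
  unfolding subcells_conv using finite_residue_cells by blast

text \<open>Each level refines the previous one into finitely many pieces. This later gives maxima,
  finite partitions and countability.\<close>

lemma finite_cells: "finite (cell n ` \<O>)"
proof (induction n)
  case 0
  have "cell 0 ` \<O> \<subseteq> {\<O>}" using cell_0 by auto
  thus ?case by (rule finite_subset) simp
next
  case (Suc n)
  have "cell (Suc n) ` \<O> \<subseteq> (\<Union>C\<in>cell n ` \<O>. cell (Suc n) ` C)"
    using cell_self by blast
  moreover have "finite (\<Union>C\<in>cell n ` \<O>. cell (Suc n) ` C)"
    using Suc finite_subcells by (intro finite_UN_I) auto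
  ultimately show ?case by (rule finite_subset)
qed

lemma cell_partition: "m \<le> n \<Longrightarrow> cell m a = \<Union>(cell n ` cell m a)"
  using cell_self cell_mono cell_eqI by blast

lemma disjoint_cells: "disjoint_family_on (\<lambda>C. C) (cell n ` A)"
proof -
  have "C \<inter> C' = {}" if "C \<in> cell n ` A" "C' \<in> cell n ` A" "C \<noteq> C'" for C C'
    using that cell_eqI by blast
  thus ?thesis by (simp add: disjoint_family_on_def)
qed

section \<open>The Haar measure of a disc\<close>

lemma sets_haar: "sets \<mu> = sets (restrict_space borel \<O>)"
  using haar by (simp add: normalized_haar_measure_def)

lemma space_haar: "space \<mu> = \<O>"
  using sets_eq_imp_space_eq[OF sets_haar] by (simp add: space_restrict_space)

lemma integers_borel: "\<O> \<in> sets borel"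
proof -
  have "\<O> = cball 0 1" by (auto simp: mem_integers dist_eq_av)
  thus ?thesis by simp
qed

lemma sets_haar_iff: "A \<in> sets \<mu> \<longleftrightarrow> A \<subseteq> \<O> \<and> A \<in> sets borel"
  unfolding sets_haar using integers_borel
  by (subst sets_restrict_space_iff) auto

lemma disc_sets: "D \<in> discs av q \<Longrightarrow> D \<in> sets \<mu>"
  by (auto simp: discs_def sets_haar_iff disc_eq_cball)

lemma cell_in_discs: "a \<in> \<O> \<Longrightarrow> cell n a \<in> discs av q"
  using cell_subset[of a n] unfolding discs_def cell_def
  by (auto intro!: exI[of _ a] exI[of _ "- int n"] simp: power_int_minus power_one_over inverse_eq_divide)

lemma cell_sets: "a \<in> \<O> \<Longrightarrow> cell n a \<in> sets \<mu>"
  by (intro disc_sets cell_in_discs)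

lemma prob_space_haar: "prob_space \<mu>"
  using haar by (intro prob_spaceI) (simp add: normalized_haar_measure_def space_haar)

sublocale prob_space \<mu>
  by (rule prob_space_haar)

lemma measure_cell_translate: assumes "a \<in> \<O>" shows "measure \<mu> (cell n a) = measure \<mu> (cell n 0)"
proof -
  have "(\<lambda>x. a + x) ` cell n 0 = cell n a"
    using cell_affine[of a 0 n 0] by simp
  moreover have "cell n 0 \<in> sets \<mu>" by (intro cell_sets) (simp add: mem_integers)
  ultimately have "emeasure \<mu> (cell n a) = emeasure \<mu> (cell n 0)"
    using haar assms unfolding normalized_haar_measure_def by metis
  thus ?thesis by (simp add: measure_def)
qed

text \<open>A cell is the disjoint union of \<open>q\<close> cells of the next level, which have
  equal measure by translation invariance.\<close>

lemma measure_cell: assumes "a \<in> \<O>" shows "measure \<mu> (cell n a) = (1 / real q) ^ n"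
  using assms
proof (induction n arbitrary: a)
  case 0
  thus ?case using prob_space by (simp add: cell_0 space_haar)
next
  case (Suc n)
  have sub: "b \<in> \<O>" if "b \<in> cell n a" for b using that cell_subset Suc.prems by blast
  have "measure \<mu> (\<Union>C\<in>cell (Suc n) ` cell n a. C) = (\<Sum>C\<in>cell (Suc n) ` cell n a. measure \<mu> C)"
    by (rule finite_measure_finite_Union)
       (use finite_subcells disjoint_cells cell_sets sub in auto)
  also have "(\<Union>C\<in>cell (Suc n) ` cell n a. C) = cell n a"
    using cell_partition[of n "Suc n" a] by simp
  also have "(\<Sum>C\<in>cell (Suc n) ` cell n a. measure \<mu> C)
           = (\<Sum>C\<in>cell (Suc n) ` cell n a. measure \<mu> (cell (Suc n) 0))"
    by (intro sum.cong refl) (use measure_cell_translate sub in auto)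
  also have "\<dots> = real q * measure \<mu> (cell (Suc n) 0)"
    by (simp add: card_subcells)
  finally show ?case using Suc q_ge_2 measure_cell_translate[OF Suc.prems, of "Suc n"]
    by (simp add: field_simps)
qed

text \<open>Makes the difference of two consecutive averages at a point a term of the
  variation.\<close>

lemma cell_in_children:
  assumes "a \<in> \<O>" shows "cell (Suc n) a \<in> disc_children av q \<mu> (cell n a)"
  using assms cell_mono[of n "Suc n" a] by (simp add: disc_children_def cell_in_discs measure_cell)

text \<open>The level of a cell can be recovered from its measure, whatever the centres are.\<close>

lemma inj_cell: assumes "range a \<subseteq> \<O>" shows "inj (\<lambda>n. cell n (a n))"
proof (rule injI)
  fix m n assume "cell m (a m) = cell n (a n)"
  moreover have "a m \<in> \<O>" "a n \<in> \<O>" using assms by auto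
  ultimately have "(1 / real q) ^ m = (1 / real q) ^ n" by (metis measure_cell)
  thus "m = n" using power_inject_exp'[of "1 / real q" m n] q_ge_2 by simp
qed

section \<open>Discs as an intersection-stable generator of the Borel sets\<close>

text \<open>The empty set is added because disjoint cells must have their intersection in the
  family.\<close>

definition cells :: "'a set set" where
  "cells = insert {} (\<Union>n. cell n ` \<O>)"

lemma countable_cells: "countable cells"
  unfolding cells_def by (intro countable_insert countable_UN) (auto intro: countable_finite finite_cells)

lemma Int_stable_cells: "Int_stable cells"
proof -
  have "cell m a \<inter> cell n b \<in> cells" if "a \<in> \<O>" "b \<in> \<O>" "m \<le> n" for m n a b
    using \<open>m \<le> n\<close> by (cases rule: cell_cases[of m n b a])
      (use that in \<open>auto simp: cells_def Int_absorb1 Int_commute[of "cell m a"]\<close>)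
  hence "cell m a \<inter> cell n b \<in> cells" if "a \<in> \<O>" "b \<in> \<O>" for m n a b
    using that by (metis Int_commute linear)
  moreover have "{} \<in> cells" by (simp add: cells_def)
  ultimately show ?thesis unfolding Int_stable_def
    by (auto simp: cells_def)
qed

lemma cells_subset: "cells \<subseteq> Pow \<O>"
  unfolding cells_def using cell_subset by blast

lemma exists_cell_subset_ball: assumes "e > 0" shows "\<exists>n. cell n a \<subseteq> ball a e"
proof -
  obtain n where "(1 / real q) ^ n < e"
    using real_arch_pow_inv[OF assms, of "1 / real q"] q_ge_2 by auto
  hence "cell n a \<subseteq> ball a e" by (auto simp: mem_cell dist_eq_av av_minus_commute)
  thus ?thesis ..
qed

text \<open>The trace on \<open>\<O>\<close> of an open set is the union of the cells it contains,
  and there are only countably many cells.\<close>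

lemma sets_haar_eq_sigma_cells: "sets \<mu> = sigma_sets \<O> cells"
proof
  show "sigma_sets \<O> cells \<subseteq> sets \<mu>"
    using cell_sets sets.sigma_sets_subset[of cells \<mu>] by (auto simp: cells_def space_haar)
  \<comment> \<open>Borel measurability of the identity says that the trace on \<open>\<O>\<close>
    of every Borel set lies in the generated sigma-algebra; it need only be checked on open
    sets.\<close>
  have "id \<in> borel_measurable (sigma \<O> cells)"
  proof (rule borel_measurableI)
    fix S :: "'a set" assume S: "open S"
    let ?U = "{C \<in> cells. C \<subseteq> S}"
    have "S \<inter> \<O> \<subseteq> \<Union>?U"
    proof
      fix x assume x: "x \<in> S \<inter> \<O>"
      then obtain e where "e > 0" "ball x e \<subseteq> S" using S openE by blast
      then obtain n where "cell n x \<subseteq> S" using exists_cell_subset_ball[of e x] by blast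
      moreover have "cell n x \<in> cells" using x by (auto simp: cells_def)
      ultimately show "x \<in> \<Union>?U" using cell_self by blast
    qed
    hence "S \<inter> \<O> = \<Union>?U" using cells_subset by auto
    moreover have "countable ?U" using countable_cells by (rule countable_subset[rotated]) auto
    moreover have "C \<in> sets (sigma \<O> cells)" if "C \<in> ?U" for C
      using that cells_subset by auto
    ultimately have "S \<inter> \<O> \<in> sets (sigma \<O> cells)"
      by (metis (no_types, lifting) sets.countable_Union subsetI)
    thus "id -` S \<inter> space (sigma \<O> cells) \<in> sets (sigma \<O> cells)"
      using cells_subset by (simp add: space_measure_of)
  qed
  hence "A \<inter> \<O> \<in> sigma_sets \<O> cells" if "A \<in> sets borel" for A
    using measurable_sets[of id "sigma \<O> cells" borel A] that cells_subset
    by (simp add: space_measure_of)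
  thus "sets \<mu> \<subseteq> sigma_sets \<O> cells"
    unfolding sets_haar by (auto simp: sets_restrict_space Int_commute)
qed

section \<open>Almost everywhere equality from integrals, and uniqueness of continuous
  versions\<close>

lemma set_integrable_haar:
  fixes h :: "'a \<Rightarrow> real"
  shows "A \<in> sets \<mu> \<Longrightarrow> integrable \<mu> h \<Longrightarrow> set_integrable \<mu> A h"
  unfolding set_integrable_def by (rule integrable_mult_indicator)

text \<open>The sets over which both integrals agree form a Dynkin system, and the cells are an
  intersection-stable generator.\<close>

lemma AE_eq_if_cell_integrals_eq:
  fixes f g :: "'a \<Rightarrow> real"
  assumes f: "integrable \<mu> f" and g: "integrable \<mu> g"
    and eq: "\<And>n a. a \<in> \<O> \<Longrightarrow> (LINT x:cell n a|\<mu>. f x) = (LINT x:cell n a|\<mu>. g x)"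
  shows "AE x in \<mu>. f x = g x"
proof (rule density_unique_real[OF f g])
  \<comment> \<open>The whole space is the cell of level 0; its integral is what the complement step
    subtracts from.\<close>
  have total: "(LINT x:\<O>|\<mu>. f x) = (LINT x:\<O>|\<mu>. g x)"
    using eq[of 0 0] cell_0[of 0] by (simp add: mem_integers)
  fix A assume "A \<in> sets \<mu>"
  hence "A \<in> sigma_sets \<O> cells" by (simp add: sets_haar_eq_sigma_cells)
  thus "(LINT x:A|\<mu>. f x) = (LINT x:A|\<mu>. g x)"
  proof (induction rule: sigma_sets_induct_disjoint[OF Int_stable_cells cells_subset, consumes 1, case_names basic empty compl union])
    case (basic A)
    thus ?case using eq by (auto simp: cells_def set_lebesgue_integral_def)
  next
    case empty
    show ?case by (simp add: set_lebesgue_integral_def)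
  next
    case (compl A)
    hence A: "A \<in> sets \<mu>" by (simp add: sets_haar_eq_sigma_cells)
    have "(LINT x:\<O>|\<mu>. h x) = (LINT x:A|\<mu>. h x) + (LINT x:\<O> - A|\<mu>. h x)"
      if "integrable \<mu> h" for h :: "'a \<Rightarrow> real"
    proof -
      have "A \<union> (\<O> - A) = \<O>" using A sets_haar_iff by auto
      moreover have "\<O> - A \<in> sets \<mu>" using A sets.compl_sets[of A \<mu>] by (simp add: space_haar)
      ultimately show ?thesis using set_integral_Un[of A "\<O> - A" \<mu> h] set_integrable_haar A that by auto
    qed
    thus ?case using f g total compl by fastforce
  next
    case (union A)
    have A: "A i \<in> sets \<mu>" for i using union by (auto simp: sets_haar_eq_sigma_cells)
    have "(LINT x:(\<Union>i. A i)|\<mu>. h x) = (\<Sum>i. LINT x:A i|\<mu>. h x)"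
      if "integrable \<mu> h" for h :: "'a \<Rightarrow> real"
      using that A union(1) by (intro lebesgue_integral_countable_add set_integrable_haar)
        (auto simp: disjoint_family_on_def)
    thus ?case using f g union by simp
  qed
qed

text \<open>If the functions differed at \<open>x\<close>, continuity would make them differ on a
  whole disc about \<open>x\<close>, which has positive measure.\<close>

lemma AE_eq_imp_eq:
  fixes g h :: "'a \<Rightarrow> real"
  assumes g: "continuous_on \<O> g" and h: "continuous_on \<O> h"
    and ae: "AE x in \<mu>. g x = h x" and x: "x \<in> \<O>"
  shows "g x = h x"
proof (rule ccontr)
  assume ne: "g x \<noteq> h x"
  have cont: "continuous_on \<O> (\<lambda>y. \<bar>g y - h y\<bar>)" by (intro continuous_intros g h)
  \<comment> \<open>The tolerance is the gap at \<open>x\<close> itself, so the gap cannot close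
    within distance \<open>d\<close>.\<close>
  obtain d where "d > 0" and d: "\<forall>y\<in>\<O>. dist y x < d \<longrightarrow> dist \<bar>g y - h y\<bar> \<bar>g x - h x\<bar> < \<bar>g x - h x\<bar>"
    using cont x ne unfolding continuous_on_iff by (metis diff_eq_eq add_0 zero_less_abs_iff)
  obtain n where n: "cell n x \<subseteq> ball x d" using exists_cell_subset_ball[OF \<open>d > 0\<close>] by blast
  have "g y \<noteq> h y" if "y \<in> cell n x" for y
    using that d n cell_subset[OF x] by (force simp: dist_commute dist_real_def)
  with ae have "AE y in \<mu>. y \<notin> cell n x" by (auto elim: eventually_mono)
  hence "measure \<mu> (cell n x) = 0"
    using prob_eq_0[OF cell_sets[OF x]] by simp
  thus False using measure_cell[OF x, of n] q_ge_2 by simp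
qed

section \<open>Averages over discs and their increments under finite variation\<close>

context
  fixes f :: "'a \<Rightarrow> real"
  assumes f: "integrable \<mu> f"
    and finite_variation: "berkovich_variation av q \<mu> f < \<infinity>"
begin

definition cell_average :: "nat \<Rightarrow> 'a \<Rightarrow> real" where
  "cell_average n x = disc_mean \<mu> f (cell n x)"

definition increment :: "nat \<Rightarrow> 'a \<Rightarrow> real" where
  "increment n x = cell_average (Suc n) x - cell_average n x"

lemma cell_average_cong: "y \<in> cell n x \<Longrightarrow> cell_average n y = cell_average n x"
  unfolding cell_average_def by (drule cell_eqI) simp

text \<open>An average depends only on the cell, and each level has finitely many cells. Hence the
  largest increment of a level is attained.\<close>

lemma finite_increments: "finite (increment n ` \<O>)"
proof -
  have "cell_average k ` \<O> = disc_mean \<mu> f ` cell k ` \<O>" for k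
    by (auto simp: cell_average_def image_image)
  hence fin: "finite (cell_average k ` \<O>)" for k using finite_cells by simp
  have "increment n ` \<O> \<subseteq> (\<lambda>(s, t). s - t) ` (cell_average (Suc n) ` \<O> \<times> cell_average n ` \<O>)"
    by (auto simp: increment_def)
  thus ?thesis using fin by (meson finite_SigmaI finite_imageI finite_subset)
qed

text \<open>The increment is a single term of the inner sum of the variation, and all terms are
  nonnegative.\<close>

lemma increment_le_infsum:
  assumes "x \<in> \<O>"
  shows "ennreal \<bar>increment n x\<bar> \<le> (\<Sum>\<^sub>\<infinity>D' \<in> disc_children av q \<mu> (cell n x).
           ennreal \<bar>disc_mean \<mu> f D' - disc_mean \<mu> f (cell n x)\<bar>)"
proof -
  have "ennreal \<bar>increment n x\<bar> = (\<Sum>\<^sub>\<infinity>D' \<in> {cell (Suc n) x}.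
           ennreal \<bar>disc_mean \<mu> f D' - disc_mean \<mu> f (cell n x)\<bar>)"
    by (simp add: increment_def cell_average_def)
  also have "\<dots> \<le> (\<Sum>\<^sub>\<infinity>D' \<in> disc_children av q \<mu> (cell n x).
           ennreal \<bar>disc_mean \<mu> f D' - disc_mean \<mu> f (cell n x)\<bar>)"
    using cell_in_children[OF assms, of n] by (intro infsum_mono_neutral nonneg_summable_on_complete) auto
  finally show ?thesis .
qed

text \<open>
  Discs of different levels are distinct, so choosing one disc per level that carries the largest
  increment bounds the sum of these maxima by the variation.
\<close>

lemma summable_increment_bound:
  obtains c :: "nat \<Rightarrow> real" where "summable c" "\<And>n x. x \<in> \<O> \<Longrightarrow> \<bar>increment n x\<bar> \<le> c n"
proof -
  have "\<exists>a\<in>\<O>. \<forall>x\<in>\<O>. \<bar>increment n x\<bar> \<le> \<bar>increment n a\<bar>" for n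
  proof -
    let ?S = "(\<lambda>x. \<bar>increment n x\<bar>) ` \<O>"
    have "?S = abs ` increment n ` \<O>" by (simp add: image_image)
    hence fin: "finite ?S" using finite_increments by simp
    have "0 \<in> \<O>" by (simp add: mem_integers)
    hence "Max ?S \<in> ?S" using fin by (intro Max_in) auto
    then obtain a where "a \<in> \<O>" "Max ?S = \<bar>increment n a\<bar>" by blast
    thus ?thesis using Max_ge[OF fin] by (metis imageI)
  qed
  then obtain a where a: "\<And>n. a n \<in> \<O>"
    and max: "\<And>n x. x \<in> \<O> \<Longrightarrow> \<bar>increment n x\<bar> \<le> \<bar>increment n (a n)\<bar>" by metis
  define c where "c n = \<bar>increment n (a n)\<bar>" for n
  define V where "V D = (\<Sum>\<^sub>\<infinity>D' \<in> disc_children av q \<mu> D.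
           ennreal \<bar>disc_mean \<mu> f D' - disc_mean \<mu> f D\<bar>)" for D
  have total: "infsum V (discs av q) < \<infinity>"
    using finite_variation unfolding berkovich_variation_def V_def .
  have inj: "inj (\<lambda>n. cell n (a n))" using a by (intro inj_cell) auto
  have "ennreal (\<Sum>n<N. c n) \<le> infsum V (discs av q)" for N
  proof -
    have "ennreal (\<Sum>n<N. c n) = (\<Sum>n<N. ennreal (c n))" by (simp add: c_def)
    also have "\<dots> \<le> (\<Sum>n<N. V (cell n (a n)))"
      unfolding c_def V_def using a by (intro sum_mono increment_le_infsum)
    also have "\<dots> = sum V ((\<lambda>n. cell n (a n)) ` {..<N})"
      using inj by (subst sum.reindex) (auto intro: inj_on_subset)
    also have "\<dots> = infsum V ((\<lambda>n. cell n (a n)) ` {..<N})" by simp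
    also have "\<dots> \<le> infsum V (discs av q)"
      using a cell_in_discs by (intro infsum_mono_neutral nonneg_summable_on_complete) auto
    finally show ?thesis .
  qed
  \<comment> \<open>Finiteness of the variation is essential here, because \<open>enn2real\<close>
    sends infinity to 0.\<close>
  hence "(\<Sum>n<N. c n) \<le> enn2real (infsum V (discs av q))" for N
    using total enn2real_mono[of "ennreal (\<Sum>n<N. c n)" "infsum V (discs av q)"]
    by (simp add: c_def sum_nonneg)
  hence "summable c" by (intro summableI_nonneg_bounded) (auto simp: c_def)
  thus ?thesis using max that by (simp add: c_def)
qed

text \<open>The average is constant on each cell of level \<open>n\<close>, so the radius of the
  cell serves as delta for every \<open>e\<close>.\<close>

lemma continuous_cell_average: "continuous_on \<O> (cell_average n)"
  unfolding continuous_on_iff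
proof (intro ballI allI impI)
  fix x and e :: real assume "x \<in> \<O>" "e > 0"
  have "dist (cell_average n y) (cell_average n x) < e" if "dist y x < (1 / real q) ^ n" for y
    using cell_average_cong[of y n x] that \<open>e > 0\<close> by (simp add: mem_cell dist_eq_av)
  thus "\<exists>d>0. \<forall>y\<in>\<O>. dist y x < d \<longrightarrow> dist (cell_average n y) (cell_average n x) < e"
    using radius_pos[of n] by blast
qed

text \<open>The larger cell splits into finitely many cells of level \<open>n\<close>. On each of
  them the average is constant, and multiplying it by the positive measure of the cell returns the
  integral of \<open>f\<close>.\<close>

lemma cell_integral_average:
  assumes "a \<in> \<O>" "m \<le> n" and int: "integrable \<mu> (cell_average n)"
  shows "(LINT x:cell m a|\<mu>. cell_average n x) = (LINT x:cell m a|\<mu>. f x)"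
proof -
  let ?P = "cell n ` cell m a"
  have sub: "b \<in> \<O>" if "b \<in> cell m a" for b using that cell_subset assms by blast
  have "finite ?P" using finite_cells[of n] by (rule finite_subset[rotated]) (use sub in auto)
  have split: "(LINT x:cell m a|\<mu>. h x) = (\<Sum>C\<in>?P. LINT x:C|\<mu>. h x)"
    if "integrable \<mu> h" for h :: "'a \<Rightarrow> real"
  proof -
    have "(LINT x:(\<Union>C\<in>?P. C)|\<mu>. h x) = (\<Sum>C\<in>?P. LINT x:C|\<mu>. h x)"
      using that \<open>finite ?P\<close> disjoint_cells cell_sets sub set_integrable_haar
      by (intro set_integral_finite_Union) auto
    thus ?thesis using cell_partition[OF assms(2), of a] by simp
  qed
  have "(LINT x:cell n b|\<mu>. cell_average n x) = (LINT x:cell n b|\<mu>. f x)" if "b \<in> \<O>" for b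
  proof -
    have "(LINT x:cell n b|\<mu>. cell_average n x) = (LINT x:cell n b|\<mu>. cell_average n b)"
      using cell_sets[OF that] by (intro set_lebesgue_integral_cong) (auto simp: cell_average_cong)
    also have "\<dots> = measure \<mu> (cell n b) * cell_average n b"
      using cell_sets[OF that, of n] by (simp add: set_lebesgue_integral_def)
    also have "\<dots> = (LINT x:cell n b|\<mu>. f x)"
      using measure_cell[OF that, of n] q_ge_2
      by (simp add: cell_average_def disc_mean_def)
    finally show ?thesis .
  qed
  thus ?thesis unfolding split[OF int] split[OF f] using sub by (auto intro!: sum.cong)
qed

section \<open>The continuous limit of the averages\<close>

lemma continuous_version: "\<exists>g. continuous_on \<O> g \<and> (AE x in \<mu>. f x = g x)"
proof -
  obtain c where "summable c" and c: "\<And>n x. x \<in> \<O> \<Longrightarrow> \<bar>increment n x\<bar> \<le> c n"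
    using summable_increment_bound by blast
  \<comment> \<open>The limit is written as a telescoping series so that the M-test with majorant
    \<open>c\<close> applies.\<close>
  define g where "g x = cell_average 0 x + (\<Sum>n. increment n x)" for x
  have average_eq: "cell_average n x = cell_average 0 x + (\<Sum>i<n. increment i x)" for n x
    by (induction n) (auto simp: increment_def)
  have sums: "uniform_limit \<O> (\<lambda>n x. \<Sum>i<n. increment i x) (\<lambda>x. \<Sum>i. increment i x) sequentially"
    using c \<open>summable c\<close> by (intro Weierstrass_m_test) auto
  have lim: "uniform_limit \<O> cell_average g sequentially"
  proof -
    have "dist (cell_average n x) (g x) = dist (\<Sum>i<n. increment i x) (\<Sum>i. increment i x)" for n x
      unfolding average_eq[of n x] g_def by (simp add: dist_real_def)
    thus ?thesis using sums unfolding uniform_limit_iff by simp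
  qed
  have g: "continuous_on \<O> g"
    by (rule uniform_limit_theorem[OF _ lim]) (auto simp: continuous_cell_average)
  have meas: "h \<in> borel_measurable \<mu>" if "continuous_on \<O> h" for h :: "'a \<Rightarrow> real"
    using borel_measurable_continuous_on_restrict[OF that] measurable_cong_sets[OF sets_haar refl]
    by blast
  \<comment> \<open>The only cell of level 0 in \<open>\<O>\<close> is \<open>\<O>\<close> itself,
    so the first average is a constant. This makes the bounds below uniform in \<open>x\<close> and
    gives integrability on a probability space.\<close>
  have zero: "cell_average 0 x = cell_average 0 0" if "x \<in> \<O>" for x
    using that by (intro cell_average_cong) (simp add: cell_0 mem_integers)
  have c0: "c n \<ge> 0" for n using c[of 0 n] by (simp add: mem_integers)
  have "\<bar>cell_average n x\<bar> \<le> \<bar>cell_average 0 0\<bar> + suminf c" if "x \<in> \<O>" for n x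
  proof -
    have "\<bar>\<Sum>i<n. increment i x\<bar> \<le> (\<Sum>i<n. c i)"
      using c[OF that] by (intro order.trans[OF sum_abs] sum_mono)
    also have "\<dots> \<le> suminf c" using \<open>summable c\<close> c0 by (intro sum_le_suminf) auto
    finally show ?thesis unfolding average_eq[of n x] zero[OF that] by linarith
  qed
  hence int_avg: "integrable \<mu> (cell_average n)" for n
    using meas[OF continuous_cell_average]
    by (intro integrable_const_bound[where B = "\<bar>cell_average 0 0\<bar> + suminf c"])
       (auto simp: space_haar)
  have "\<bar>g x\<bar> \<le> \<bar>cell_average 0 0\<bar> + suminf c" if "x \<in> \<O>" for x
  proof -
    have "\<bar>\<Sum>n. increment n x\<bar> \<le> suminf c"
      using summable_norm_comparison_test norm_suminf_le c[OF that] \<open>summable c\<close>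
      by (metis real_norm_def)
    thus ?thesis unfolding g_def zero[OF that] by linarith
  qed
  hence int_g: "integrable \<mu> g"
    using meas[OF g]
    by (intro integrable_const_bound[where B = "\<bar>cell_average 0 0\<bar> + suminf c"])
       (auto simp: space_haar)
  have "(LINT x:cell m a|\<mu>. f x) = (LINT x:cell m a|\<mu>. g x)" if a: "a \<in> \<O>" for m a
  proof -
    have "\<bar>(LINT x:cell m a|\<mu>. f x) - (LINT x:cell m a|\<mu>. g x)\<bar> \<le> e" if "e > 0" for e
    proof -
      obtain N where N: "\<And>n x. n \<ge> N \<Longrightarrow> x \<in> \<O> \<Longrightarrow> dist (cell_average n x) (g x) < e"
        using lim \<open>e > 0\<close> unfolding uniform_limit_iff eventually_sequentially by blast
      \<comment> \<open>Level \<open>m\<close> or deeper is needed to compare integrals with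
        \<open>f\<close>, level \<open>N\<close> or deeper to be within \<open>e\<close> of
        \<open>g\<close>.\<close>
      define n where "n = max m N"
      have si: "set_integrable \<mu> (cell m a) (cell_average n)" "set_integrable \<mu> (cell m a) g"
        using int_avg int_g cell_sets[OF a] by (auto intro: set_integrable_haar)
      have "(LINT x:cell m a|\<mu>. f x) - (LINT x:cell m a|\<mu>. g x)
          = (LINT x:cell m a|\<mu>. cell_average n x - g x)"
        using cell_integral_average[OF a _ int_avg, of m n] si
        by (simp add: n_def)
      \<comment> \<open>The integrand, extended by zero, is bounded by \<open>e\<close> on all of
        \<open>\<O>\<close>, which has measure one.\<close>
      also have "\<bar>\<dots>\<bar> \<le> (LINT x|\<mu>. e)"
        unfolding set_lebesgue_integral_def real_norm_def[symmetric]
      proof (rule order.trans[OF integral_norm_bound integral_mono])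
        show "integrable \<mu> (\<lambda>x. norm (indicat_real (cell m a) x *\<^sub>R (cell_average n x - g x)))"
          using set_integral_diff(1)[OF si] unfolding set_integrable_def by (rule integrable_norm)
        show "norm (indicat_real (cell m a) x *\<^sub>R (cell_average n x - g x)) \<le> e"
          if "x \<in> space \<mu>" for x
          using N[of n x] that \<open>e > 0\<close>
          by (auto simp: n_def space_haar dist_real_def indicator_def)
      qed simp
      finally show ?thesis using prob_space by simp
    qed
    thus ?thesis using field_le_epsilon[of "\<bar>(LINT x:cell m a|\<mu>. f x) - (LINT x:cell m a|\<mu>. g x)\<bar>" 0]
      by auto
  qed
  hence "AE x in \<mu>. f x = g x" by (intro AE_eq_if_cell_integrals_eq f int_g)
  thus ?thesis using g by blast
qed

end

section \<open>Passage to the completed measure\<close>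

text \<open>Changing the integrand on a null set keeps the integral, and completion changes neither
  the integral of a Borel function nor the measure of a disc.\<close>

lemma disc_mean_completion:
  assumes "h \<in> borel_measurable \<mu>" "f \<in> borel_measurable (completion \<mu>)"
    and "AE x in \<mu>. f x = h x" and "D \<in> sets \<mu>"
  shows "disc_mean (completion \<mu>) f D = disc_mean \<mu> h D"
proof -
  have "(LINT x:D|completion \<mu>. f x) = (LINT x:D|completion \<mu>. h x)"
    unfolding set_lebesgue_integral_def
  proof (rule integral_cong_AE)
    have D: "indicat_real D \<in> borel_measurable (completion \<mu>)"
      using assms(4) by (intro borel_measurable_indicator sets_completionI_sets)
    show "(\<lambda>x. indicat_real D x *\<^sub>R f x) \<in> borel_measurable (completion \<mu>)"
      using D assms(2) by (rule borel_measurable_scaleR)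
    show "(\<lambda>x. indicat_real D x *\<^sub>R h x) \<in> borel_measurable (completion \<mu>)"
      using D measurable_completion[OF assms(1)] by (rule borel_measurable_scaleR)
    show "AE x in completion \<mu>. indicat_real D x *\<^sub>R f x = indicat_real D x *\<^sub>R h x"
      using AE_completion[OF assms(3)] by eventually_elim simp
  qed
  also have "\<dots> = (LINT x:D|\<mu>. h x)"
    unfolding set_lebesgue_integral_def using assms by (intro integral_completion) auto
  finally show ?thesis using assms by (simp add: disc_mean_def)
qed

text \<open>Discs are Borel, so completion preserves their measures and hence the relation between a
  disc and its children; the means agree termwise.\<close>

lemma berkovich_variation_completion:
  assumes "h \<in> borel_measurable \<mu>" "f \<in> borel_measurable (completion \<mu>)"
    and "AE x in \<mu>. f x = h x"
  shows "berkovich_variation av q (completion \<mu>) f = berkovich_variation av q \<mu> h"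
proof -
  have "disc_children av q (completion \<mu>) D = disc_children av q \<mu> D" if "D \<in> discs av q" for D
    using that by (auto simp: disc_children_def disc_sets)
  moreover have "disc_mean (completion \<mu>) f D = disc_mean \<mu> h D" if "D \<in> discs av q" for D
    using disc_mean_completion[OF assms disc_sets[OF that]] .
  moreover have "D' \<in> discs av q" if "D' \<in> disc_children av q \<mu> D" for D D'
    using that by (simp add: disc_children_def)
  ultimately show ?thesis
    unfolding berkovich_variation_def by (intro infsum_cong) (auto intro!: infsum_cong)
qed

end

theorem theorem5p3:
  fixes av :: "'a :: {field, metric_space} \<Rightarrow> real"
    and \<pi> :: 'a and q :: nat and \<mu> :: "'a measure" and f :: "'a \<Rightarrow> real"
  assumes "nonarchimedean_field av"
    and "locally compact (UNIV :: 'a set)"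
    and "uniformizer av \<pi>"
    and "q = residue_order av \<pi>"
    and "av \<pi> = 1 / real q"
    and "normalized_haar_measure av \<mu>"
    and "integrable (completion \<mu>) f"
    and "berkovich_variation av q (completion \<mu>) f < \<infinity>"
  shows "\<exists>!g. g \<in> ring_of_integers av \<rightarrow>\<^sub>E (UNIV :: real set) \<and>
           continuous_on (ring_of_integers av) g \<and>
           (AE x in completion \<mu>. f x = g x)"
proof -
  interpret haar_integers av \<pi> q \<mu>
    using assms by (simp add: haar_integers_def haar_integers_axioms_def)
  have f: "f \<in> borel_measurable (completion \<mu>)" using assms(7) by auto
  \<comment> \<open>The function \<open>f\<close> is measurable only for the completion; a Borel
    version \<open>h\<close> has the same variation and admits the preceding construction.\<close>
  then obtain h where h: "h \<in> borel_measurable \<mu>" and fh: "AE x in \<mu>. f x = h x"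
    using completion_ex_borel_measurable_real by blast
  have "integrable (completion \<mu>) h"
    using assms(7) by (rule integrable_cong_AE_imp)
      (use h measurable_completion AE_completion[OF fh] in \<open>auto simp: eq_commute\<close>)
  hence "integrable \<mu> h" using integrable_completion[OF h] by simp
  moreover have "berkovich_variation av q \<mu> h < \<infinity>"
    using berkovich_variation_completion[OF h f fh] assms(8) by simp
  ultimately obtain g where g: "continuous_on \<O> g" and hg: "AE x in \<mu>. h x = g x"
    using continuous_version by blast
  have fg: "AE x in \<mu>. f x = g x" using fh hg by eventually_elim simp
  show ?thesis
  proof (intro ex1I conjI)
    \<comment> \<open>Restriction fixes the values off \<open>\<O>\<close>, so that uniqueness
      concerns functions on \<open>\<O>\<close> alone.\<close>
    show "restrict g \<O> \<in> \<O> \<rightarrow>\<^sub>E UNIV" by simp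
    show "continuous_on \<O> (restrict g \<O>)"
      using g by (rule continuous_on_eq) simp
    show "AE x in completion \<mu>. f x = restrict g \<O> x"
      unfolding AE_completion_iff using fg AE_space
      by eventually_elim (simp add: space_haar)
    fix g' assume g': "g' \<in> \<O> \<rightarrow>\<^sub>E UNIV \<and> continuous_on \<O> g' \<and> (AE x in completion \<mu>. f x = g' x)"
    hence "AE x in \<mu>. f x = g' x" by (simp add: AE_completion_iff)
    hence "AE x in \<mu>. g' x = g x" using fg by eventually_elim simp
    hence "g' x = g x" if "x \<in> \<O>" for x
      using AE_eq_imp_eq[OF _ g] g' that by blast
    thus "g' = restrict g \<O>" using g' by (intro extensionalityI[of _ \<O>]) (auto simp: PiE_def)
  qed
qed

end
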